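(* Let $\Omega\subset\mathbb{C}$ be a bounded domain whose boundary is the union of finitely many pairwise disjoint analytic Jordan curves $\gamma_1,\dots,\gamma_m$, $\gamma_j(t)=\Phi_j(e^{it})$. Then the set of $f\in A^\infty(\Omega)$ such that for every $j\in\{1,\dots,m\}$ the restriction $f|_{\gamma_j^*}$ is real analytic at no point of $\gamma_j^*$ is a dense $G_\delta$ subset of $A^\infty(\Omega)$.
   Context: An analytic Jordan curve is $\gamma(t)=\Phi(e^{it})$, $t\in\mathbb{R}$, with $\Phi$ injective holomorphic on an annulus $\{\rho<|z|<R\}$, $0<\rho<1<R$; $\gamma^*$ is its image. $A^\infty(\Omega)$ is the space of holomorphic $f:\Omega\to\mathbb{C}$ such that every derivative $f^{(l)}$, $l=0,1,2,\dots$, extends continuously to $\overline{\Omega}$, with the Fréchet topology given by the seminorms $\sup_{z\in\Omega}|f^{(l)}(z)|$. A function $g:\gamma_j^*\to\mathbb{C}$ is real analytic at $\gamma_j(t_0)$ if there is a power series $\sum_{n\ge0}a_n(t-t_0)^n$ with radius of convergence $\delta>0$ such that $g(\gamma_j(t))=\sum_{n\ge0}a_n(t-t_0)^n$ for all $t\in(t_0-\delta,t_0+\delta)$. *)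

theory Defs
  imports "HOL-Analysis.Analysis"
begin

definition analytic_jordan_param :: "(complex \<Rightarrow> complex) \<Rightarrow> real \<Rightarrow> real \<Rightarrow> bool" where
  "analytic_jordan_param \<Phi> \<rho> R \<longleftrightarrow>
     0 < \<rho> \<and> \<rho> < 1 \<and> 1 < R \<and>
     \<Phi> holomorphic_on {z. \<rho> < cmod z \<and> cmod z < R} \<and>
     inj_on \<Phi> {z. \<rho> < cmod z \<and> cmod z < R}"

definition curve_of :: "(complex \<Rightarrow> complex) \<Rightarrow> real \<Rightarrow> complex" where
  "curve_of \<Phi> t = \<Phi> (exp (\<i> * of_real t))"

definition curve_image :: "(complex \<Rightarrow> complex) \<Rightarrow> complex set" where
  "curve_image \<Phi> = range (curve_of \<Phi>)"

definition A_infty :: "complex set \<Rightarrow> (complex \<Rightarrow> complex) set" where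
  "A_infty \<Omega> = {f. f holomorphic_on \<Omega> \<and>
     (\<forall>l::nat. \<exists>F. continuous_on (closure \<Omega>) F \<and> (\<forall>z\<in>\<Omega>. F z = (deriv ^^ l) f z))}"

definition seminorm_dist :: "complex set \<Rightarrow> nat \<Rightarrow> (complex \<Rightarrow> complex) \<Rightarrow> (complex \<Rightarrow> complex) \<Rightarrow> real" where
  "seminorm_dist \<Omega> l f g = (SUP z\<in>\<Omega>. cmod ((deriv ^^ l) g z - (deriv ^^ l) f z))"

definition A_open :: "complex set \<Rightarrow> (complex \<Rightarrow> complex) set \<Rightarrow> bool" where
  "A_open \<Omega> U \<longleftrightarrow> U \<subseteq> A_infty \<Omega> \<and>
     (\<forall>f\<in>U. \<exists>N::nat. \<exists>\<epsilon>>0.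
        {g \<in> A_infty \<Omega>. \<forall>l\<le>N. seminorm_dist \<Omega> l f g < \<epsilon>} \<subseteq> U)"

definition A_dense :: "complex set \<Rightarrow> (complex \<Rightarrow> complex) set \<Rightarrow> bool" where
  "A_dense \<Omega> S \<longleftrightarrow> S \<subseteq> A_infty \<Omega> \<and> (\<forall>U. A_open \<Omega> U \<and> U \<noteq> {} \<longrightarrow> U \<inter> S \<noteq> {})"

definition A_G_delta :: "complex set \<Rightarrow> (complex \<Rightarrow> complex) set \<Rightarrow> bool" where
  "A_G_delta \<Omega> S \<longleftrightarrow> (\<exists>Us :: nat \<Rightarrow> (complex \<Rightarrow> complex) set.
      (\<forall>n. A_open \<Omega> (Us n)) \<and> S = (\<Inter>n. Us n))"

definition boundary_value :: "complex set \<Rightarrow> (complex \<Rightarrow> complex) \<Rightarrow> complex \<Rightarrow> complex" where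
  "boundary_value \<Omega> f w = Lim (at w within \<Omega>) f"

definition real_analytic_at_param :: "(complex \<Rightarrow> complex) \<Rightarrow> (real \<Rightarrow> complex) \<Rightarrow> real \<Rightarrow> bool" where
  "real_analytic_at_param g \<gamma> t0 \<longleftrightarrow>
     (\<exists>a :: nat \<Rightarrow> complex. \<exists>\<delta>>0. ereal \<delta> \<le> conv_radius a \<and>
        (\<forall>t. \<bar>t - t0\<bar> < \<delta> \<longrightarrow> (\<lambda>n. a n * of_real (t - t0) ^ n) sums g (\<gamma> t)))"

end

theory Submission
  imports Defs "HOL-Complex_Analysis.Complex_Analysis"
begin

text \<open>The boundary values of \<open>f\<close> are real analytic somewhere on \<open>\<gamma>\<close> iff for some rational \<open>q\<close>
  and some \<open>k, M\<close> the function \<open>t \<mapsto> f (\<gamma> t)\<close> extends to a holomorphic function bounded by \<open>M\<close> on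
  the complex disc of radius \<open>1/k\<close> about \<open>q\<close>. Each of these countably many conditions is closed by
  Montel's theorem. It has empty interior: the holomorphic extension of the curve is an open map,
  so by the Jordan curve theorem it attains, inside the disc, a value \<open>w\<close> outside the closure of
  \<open>\<Omega>\<close>, and adding a small multiple of \<open>1 / (z - w)\<close> destroys extendability. The Baire category
  theorem in the complete space \<open>A_infty \<Omega>\<close> finishes the proof.\<close>

section \<open>Uniform limits of uniformly continuous functions\<close>

lemma uniformly_continuous_on_uniform_limit:
  fixes f :: "nat \<Rightarrow> 'a::metric_space \<Rightarrow> 'b::metric_space"
  assumes lim: "uniform_limit S f g sequentially"
    and cont: "\<And>n. uniformly_continuous_on S (f n)"
  shows "uniformly_continuous_on S g"
  unfolding uniformly_continuous_on_def
proof (intro allI impI)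
  fix e :: real assume "e > 0"
  then have e3: "e / 3 > 0" by simp
  then obtain n where n: "\<And>x. x \<in> S \<Longrightarrow> dist (f n x) (g x) < e / 3"
    using lim unfolding uniform_limit_sequentially_iff by blast
  obtain d where "d > 0" and d: "\<And>x y. x \<in> S \<Longrightarrow> y \<in> S \<Longrightarrow> dist y x < d \<Longrightarrow> dist (f n y) (f n x) < e / 3"
    using cont[of n] e3 unfolding uniformly_continuous_on_def by metis
  have "dist (g y) (g x) < e" if "x \<in> S" "y \<in> S" "dist y x < d" for x y
  proof -
    have "dist (g y) (g x) \<le> dist (f n y) (g y) + dist (f n y) (f n x) + dist (f n x) (g x)"
      using dist_triangle[of "g y" "g x" "f n y"] dist_triangle[of "f n y" "g x" "f n x"]
      by (simp add: dist_commute)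
    then show ?thesis
      using n[OF that(1)] n[OF that(2)] d[OF that] by linarith
  qed
  then show "\<exists>d>0. \<forall>x\<in>S. \<forall>x'\<in>S. dist x' x < d \<longrightarrow> dist (g x') (g x) < e"
    using \<open>d > 0\<close> by blast
qed

section \<open>The space of functions smooth up to the boundary\<close>

locale bounded_open =
  fixes \<Omega> :: "complex set"
  assumes open_\<Omega>: "open \<Omega>" and nonempty_\<Omega>: "\<Omega> \<noteq> {}" and bounded_\<Omega>: "bounded \<Omega>"
begin

definition nhd :: "(complex \<Rightarrow> complex) \<Rightarrow> nat \<Rightarrow> real \<Rightarrow> (complex \<Rightarrow> complex) set" where
  "nhd f N \<epsilon> = {g \<in> A_infty \<Omega>. \<forall>l\<le>N. seminorm_dist \<Omega> l f g < \<epsilon>}"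

lemma compact_closure_\<Omega>: "compact (closure \<Omega>)"
  using bounded_\<Omega> by (simp add: compact_closure)

lemma A_infty_holomorphic: "f \<in> A_infty \<Omega> \<Longrightarrow> f holomorphic_on \<Omega>"
  by (simp add: A_infty_def)

text \<open>Since \<open>closure \<Omega>\<close> is compact, a continuous extension to it exists
  exactly when the function is uniformly continuous on \<open>\<Omega>\<close>. This form mentions
  no extension and passes directly to uniform limits.\<close>

lemma A_infty_iff_uniformly_continuous:
  "f \<in> A_infty \<Omega> \<longleftrightarrow>
     f holomorphic_on \<Omega> \<and> (\<forall>l. uniformly_continuous_on \<Omega> ((deriv ^^ l) f))"
proof
  assume f: "f \<in> A_infty \<Omega>"
  have "uniformly_continuous_on \<Omega> ((deriv ^^ l) f)" for l
  proof -
    obtain F where F: "continuous_on (closure \<Omega>) F" "\<And>z. z \<in> \<Omega> \<Longrightarrow> F z = (deriv ^^ l) f z"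
      using f unfolding A_infty_def by blast
    have "uniformly_continuous_on (closure \<Omega>) F"
      using F(1) compact_closure_\<Omega> by (rule compact_uniformly_continuous)
    then show ?thesis
      using F(2) closure_subset[of \<Omega>] unfolding uniformly_continuous_on_def by (metis subsetD)
  qed
  then show "f holomorphic_on \<Omega> \<and> (\<forall>l. uniformly_continuous_on \<Omega> ((deriv ^^ l) f))"
    using f A_infty_holomorphic by blast
next
  assume *: "f holomorphic_on \<Omega> \<and> (\<forall>l. uniformly_continuous_on \<Omega> ((deriv ^^ l) f))"
  have "\<exists>F. continuous_on (closure \<Omega>) F \<and> (\<forall>z\<in>\<Omega>. F z = (deriv ^^ l) f z)" for l
  proof -
    obtain F where "uniformly_continuous_on (closure \<Omega>) F" "\<And>z. z \<in> \<Omega> \<Longrightarrow> (deriv ^^ l) f z = F z"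
      using * uniformly_continuous_on_extension_on_closure[of \<Omega> "(deriv ^^ l) f"] by metis
    then show ?thesis
      using uniformly_continuous_imp_continuous by (intro exI[of _ F]) auto
  qed
  then show "f \<in> A_infty \<Omega>"
    using * unfolding A_infty_def by blast
qed

lemma A_infty_deriv_bounded:
  assumes "f \<in> A_infty \<Omega>"
  shows "\<exists>B. \<forall>z\<in>\<Omega>. cmod ((deriv ^^ l) f z) \<le> B"
proof -
  obtain F where F: "continuous_on (closure \<Omega>) F" "\<And>z. z \<in> \<Omega> \<Longrightarrow> F z = (deriv ^^ l) f z"
    using assms unfolding A_infty_def by blast
  have "bounded (F ` closure \<Omega>)"
    using compact_continuous_image[OF F(1) compact_closure_\<Omega>] compact_imp_bounded by blast
  then obtain B where "\<And>z. z \<in> closure \<Omega> \<Longrightarrow> cmod (F z) \<le> B"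
    unfolding bounded_iff by blast
  then show ?thesis
    using F(2) closure_subset by (metis subsetD)
qed

text \<open>A real \<open>SUP\<close> bounds its family only if the family is bounded above.
  Membership in \<open>A_infty\<close> supplies this, because each derivative extends continuously
  to a compact set.\<close>

lemma seminorm_dist_ge:
  assumes "f \<in> A_infty \<Omega>" "g \<in> A_infty \<Omega>" "z \<in> \<Omega>"
  shows "cmod ((deriv ^^ l) g z - (deriv ^^ l) f z) \<le> seminorm_dist \<Omega> l f g"
proof -
  obtain B where B: "\<And>z. z \<in> \<Omega> \<Longrightarrow> cmod ((deriv ^^ l) f z) \<le> B"
    using A_infty_deriv_bounded[OF assms(1)] by blast
  obtain C where C: "\<And>z. z \<in> \<Omega> \<Longrightarrow> cmod ((deriv ^^ l) g z) \<le> C"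
    using A_infty_deriv_bounded[OF assms(2)] by blast
  have "bdd_above ((\<lambda>z. cmod ((deriv ^^ l) g z - (deriv ^^ l) f z)) ` \<Omega>)"
  proof (rule bdd_aboveI2)
    fix z assume "z \<in> \<Omega>"
    then show "cmod ((deriv ^^ l) g z - (deriv ^^ l) f z) \<le> C + B"
      using B[of z] C[of z] norm_triangle_ineq4[of "(deriv ^^ l) g z" "(deriv ^^ l) f z"] by linarith
  qed
  then show ?thesis
    unfolding seminorm_dist_def using assms(3) by (rule cSUP_upper[rotated])
qed

lemma seminorm_dist_le:
  assumes "\<And>z. z \<in> \<Omega> \<Longrightarrow> cmod ((deriv ^^ l) g z - (deriv ^^ l) f z) \<le> e"
  shows "seminorm_dist \<Omega> l f g \<le> e"
  unfolding seminorm_dist_def using nonempty_\<Omega> assms by (rule cSUP_least)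

lemma seminorm_dist_triangle:
  assumes "f \<in> A_infty \<Omega>" "g \<in> A_infty \<Omega>" "h \<in> A_infty \<Omega>"
  shows "seminorm_dist \<Omega> l f h \<le> seminorm_dist \<Omega> l f g + seminorm_dist \<Omega> l g h"
proof (rule seminorm_dist_le)
  fix z assume "z \<in> \<Omega>"
  then show "cmod ((deriv ^^ l) h z - (deriv ^^ l) f z)
      \<le> seminorm_dist \<Omega> l f g + seminorm_dist \<Omega> l g h"
    using seminorm_dist_ge[OF assms(1,2), of z l] seminorm_dist_ge[OF assms(2,3), of z l]
      norm_triangle_ineq[of "(deriv ^^ l) h z - (deriv ^^ l) g z" "(deriv ^^ l) g z - (deriv ^^ l) f z"]
    by simp
qed

lemma seminorm_dist_self: "seminorm_dist \<Omega> l f f = 0"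
  unfolding seminorm_dist_def using nonempty_\<Omega> by simp

lemma centre_in_nhd: "f \<in> A_infty \<Omega> \<Longrightarrow> \<epsilon> > 0 \<Longrightarrow> f \<in> nhd f N \<epsilon>"
  by (simp add: nhd_def seminorm_dist_self)

lemma nhd_mono: "N \<le> N' \<Longrightarrow> \<epsilon>' \<le> \<epsilon> \<Longrightarrow> nhd f N' \<epsilon>' \<subseteq> nhd f N \<epsilon>"
  by (clarsimp simp: nhd_def) (meson order_less_le_trans order_trans)

section \<open>The topology of \<open>A_infty\<close> through basic neighbourhoods\<close>

lemma A_open_iff_nhd:
  "A_open \<Omega> U \<longleftrightarrow> U \<subseteq> A_infty \<Omega> \<and> (\<forall>f\<in>U. \<exists>N. \<exists>\<epsilon>>0. nhd f N \<epsilon> \<subseteq> U)"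
  unfolding A_open_def nhd_def ..

lemma A_open_A_infty: "A_open \<Omega> (A_infty \<Omega>)"
  unfolding A_open_def using zero_less_one by blast

lemma A_open_nhd:
  assumes f: "f \<in> A_infty \<Omega>"
  shows "A_open \<Omega> (nhd f N \<epsilon>)"
  unfolding A_open_iff_nhd
proof (intro conjI ballI)
  show "nhd f N \<epsilon> \<subseteq> A_infty \<Omega>"
    by (auto simp: nhd_def)
next
  fix g assume g: "g \<in> nhd f N \<epsilon>"
  then have gA: "g \<in> A_infty \<Omega>"
    by (simp add: nhd_def)
  \<comment> \<open>The smallest slack left by \<open>g\<close> among the finitely many orders up to
    \<open>N\<close>, hence still positive; the triangle inequality then works for all these orders
    at once.\<close>
  define r where "r = Min ((\<lambda>l. \<epsilon> - seminorm_dist \<Omega> l f g) ` {..N})"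
  have "r > 0"
    unfolding r_def using g by (subst Min_gr_iff) (auto simp: nhd_def)
  moreover have "nhd g N r \<subseteq> nhd f N \<epsilon>"
  proof
    fix h assume h: "h \<in> nhd g N r"
    then have hA: "h \<in> A_infty \<Omega>"
      by (simp add: nhd_def)
    have "seminorm_dist \<Omega> l f h < \<epsilon>" if "l \<le> N" for l
    proof -
      have "seminorm_dist \<Omega> l g h < r"
        using h that by (simp add: nhd_def)
      moreover have "r \<le> \<epsilon> - seminorm_dist \<Omega> l f g"
        unfolding r_def using that by (intro Min_le) auto
      ultimately show ?thesis
        using seminorm_dist_triangle[OF f gA hA, of l] by linarith
    qed
    then show "h \<in> nhd f N \<epsilon>"
      using hA by (simp add: nhd_def)
  qed
  ultimately show "\<exists>N'. \<exists>r>0. nhd g N' r \<subseteq> nhd f N \<epsilon>"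
    by blast
qed

lemma A_open_Int:
  assumes "A_open \<Omega> U" "A_open \<Omega> V"
  shows "A_open \<Omega> (U \<inter> V)"
  unfolding A_open_iff_nhd
proof (intro conjI ballI)
  show "U \<inter> V \<subseteq> A_infty \<Omega>"
    using assms by (auto simp: A_open_def)
next
  fix f assume "f \<in> U \<inter> V"
  then obtain N \<epsilon> N' \<epsilon>' where "\<epsilon> > 0" "nhd f N \<epsilon> \<subseteq> U" "\<epsilon>' > 0" "nhd f N' \<epsilon>' \<subseteq> V"
    using assms unfolding A_open_iff_nhd by (meson IntD1 IntD2)
  then have "nhd f (max N N') (min \<epsilon> \<epsilon>') \<subseteq> U \<inter> V" "min \<epsilon> \<epsilon>' > 0"
    using nhd_mono[of N "max N N'" "min \<epsilon> \<epsilon>'" \<epsilon> f] nhd_mono[of N' "max N N'" "min \<epsilon> \<epsilon>'" \<epsilon>' f]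
    by auto
  then show "\<exists>N. \<exists>\<epsilon>>0. nhd f N \<epsilon> \<subseteq> U \<inter> V"
    by blast
qed

section \<open>Completeness and the Baire category theorem\<close>

text \<open>By Weierstrass, derivatives of a uniform limit of holomorphic functions are the limits
  of the derivatives, so the separate uniform limits of each order fit together into one function.
  Uniform limits also preserve uniform continuity, which keeps the limit in
  \<open>A_infty\<close>.\<close>

lemma A_infty_complete:
  assumes f: "\<And>n. f n \<in> A_infty \<Omega>"
    and cauchy: "\<And>l. uniformly_Cauchy_on \<Omega> (\<lambda>n. (deriv ^^ l) (f n))"
  obtains g where "g \<in> A_infty \<Omega>"
    and "\<And>l. uniform_limit \<Omega> (\<lambda>n. (deriv ^^ l) (f n)) ((deriv ^^ l) g) sequentially"
proof -
  have "\<forall>l. \<exists>G. uniform_limit \<Omega> (\<lambda>n. (deriv ^^ l) (f n)) G sequentially"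
    using Cauchy_uniformly_convergent[OF cauchy] unfolding uniformly_convergent_on_def by blast
  then obtain G where G: "\<And>l. uniform_limit \<Omega> (\<lambda>n. (deriv ^^ l) (f n)) (G l) sequentially"
    by metis
  have G0: "uniform_limit \<Omega> f (G 0) sequentially"
    using G[of 0] by simp
  \<comment> \<open>Both sides are limits of the same sequence: one by Weierstrass from order 0, the
    other by the choice of \<open>G l\<close>.\<close>
  have deriv_G0: "(deriv ^^ l) (G 0) z = G l z" if "z \<in> \<Omega>" for l z
  proof (rule LIMSEQ_unique)
    show "(\<lambda>n. (deriv ^^ l) (f n) z) \<longlonglongrightarrow> (deriv ^^ l) (G 0) z"
      using higher_deriv_complex_uniform_limit[OF G0 _ _ open_\<Omega> that] f A_infty_holomorphic by simp
    show "(\<lambda>n. (deriv ^^ l) (f n) z) \<longlonglongrightarrow> G l z"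
      using tendsto_uniform_limitI[OF G that] .
  qed
  have lim: "uniform_limit \<Omega> (\<lambda>n. (deriv ^^ l) (f n)) ((deriv ^^ l) (G 0)) sequentially" for l
    using G[of l] deriv_G0 by (simp add: uniform_limit_iff)
  have "G 0 holomorphic_on \<Omega>"
  proof (rule holomorphic_uniform_sequence[OF open_\<Omega>])
    show "f n holomorphic_on \<Omega>" for n
      by (rule A_infty_holomorphic[OF f])
    fix x assume "x \<in> \<Omega>"
    then obtain d where "d > 0" "cball x d \<subseteq> \<Omega>"
      using open_\<Omega> open_contains_cball_eq by blast
    then show "\<exists>d. 0 < d \<and> cball x d \<subseteq> \<Omega> \<and> uniform_limit (cball x d) f (G 0) sequentially"
      using uniform_limit_on_subset[OF G0] by blast
  qed
  moreover have "uniformly_continuous_on \<Omega> ((deriv ^^ l) (G 0))" for l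
    using lim f by (intro uniformly_continuous_on_uniform_limit[where g = "(deriv ^^ l) (G 0)"])
      (auto simp: A_infty_iff_uniformly_continuous)
  ultimately have "G 0 \<in> A_infty \<Omega>"
    by (simp add: A_infty_iff_uniformly_continuous)
  then show ?thesis
    using lim that by blast
qed

text \<open>Non-strict inequalities survive pointwise limits, so the limit of the centres of a
  nested sequence remains in every member.\<close>

definition closed_nhd :: "(complex \<Rightarrow> complex) \<Rightarrow> nat \<Rightarrow> real \<Rightarrow> (complex \<Rightarrow> complex) set" where
  "closed_nhd f N \<epsilon> = {g \<in> A_infty \<Omega>. \<forall>l\<le>N. seminorm_dist \<Omega> l f g \<le> \<epsilon>}"

text \<open>The two requirements tied to \<open>n\<close> control more and more seminorms with radii
  tending to 0. They make the centres chosen in the Baire argument Cauchy in every seminorm.\<close>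

lemma A_open_contains_closed_nhd:
  assumes "A_open \<Omega> U" "f \<in> U"
  shows "\<exists>N \<epsilon>. n \<le> N \<and> 0 < \<epsilon> \<and> \<epsilon> \<le> (1/2)^n \<and> closed_nhd f N \<epsilon> \<subseteq> U"
proof -
  obtain N \<epsilon> where "\<epsilon> > 0" and sub: "nhd f N \<epsilon> \<subseteq> U"
    using assms unfolding A_open_iff_nhd by blast
  define \<epsilon>' where "\<epsilon>' = min (\<epsilon> / 2) ((1/2)^n)"
  have "\<epsilon>' < \<epsilon>"
    using \<open>\<epsilon> > 0\<close> by (simp add: \<epsilon>'_def min_less_iff_disj)
  then have "closed_nhd f (max n N) \<epsilon>' \<subseteq> nhd f N \<epsilon>"
    by (clarsimp simp: closed_nhd_def nhd_def) (meson max.coboundedI2 order_le_less_trans)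
  then show ?thesis
    using sub \<open>\<epsilon> > 0\<close> by (intro exI[of _ "max n N"] exI[of _ \<epsilon>']) (auto simp: \<epsilon>'_def)
qed

text \<open>The classical argument: closed neighbourhoods are nested by dependent choice, the
  \<open>n\<close>-th step entering \<open>U n\<close>, and completeness gives a common point.
  Density is assumed only on the sets \<open>nhd\<close>, which form a neighbourhood base.\<close>

theorem A_infty_Baire:
  fixes U :: "nat \<Rightarrow> (complex \<Rightarrow> complex) set"
  assumes opn: "\<And>n. A_open \<Omega> (U n)"
    and dense: "\<And>n f N \<epsilon>. f \<in> A_infty \<Omega> \<Longrightarrow> \<epsilon> > 0 \<Longrightarrow> nhd f N \<epsilon> \<inter> U n \<noteq> {}"
  shows "A_dense \<Omega> (\<Inter>n. U n)"
  unfolding A_dense_def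
proof (intro conjI allI impI)
  show "(\<Inter>n. U n) \<subseteq> A_infty \<Omega>"
    using opn[of 0] by (auto simp: A_open_def)
next
  fix W assume W: "A_open \<Omega> W \<and> W \<noteq> {}"
  \<comment> \<open>A state consists of a centre, an order and a radius. \<open>P\<close> is the
    invariant at stage \<open>n\<close>, and \<open>Q\<close> relates consecutive stages.\<close>
  define P where "P = (\<lambda>n::nat. \<lambda>(f, N, \<epsilon>::real). f \<in> A_infty \<Omega> \<and> n \<le> N \<and> 0 < \<epsilon> \<and> \<epsilon> \<le> (1/2)^n \<and>
      closed_nhd f N \<epsilon> \<subseteq> W)"
  define Q where "Q = (\<lambda>n (f, N, \<epsilon>) (f', N', \<epsilon>'). closed_nhd f' N' \<epsilon>' \<subseteq> U n \<inter> closed_nhd f N \<epsilon>)"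
  have "\<exists>x. \<forall>n. P n (x n) \<and> Q n (x n) (x (Suc n))"
  proof (rule dependent_nat_choice)
    obtain f where "f \<in> W" using W by blast
    then show "\<exists>x. P 0 x"
      using A_open_contains_closed_nhd[of W f 0] W unfolding P_def A_open_def by auto
  next
    fix x n assume "P n x"
    obtain f N \<epsilon> where x: "x = (f, N, \<epsilon>)" by (cases x)
    have f: "f \<in> A_infty \<Omega>" "\<epsilon> > 0" "closed_nhd f N \<epsilon> \<subseteq> W"
      using \<open>P n x\<close> by (auto simp: P_def x)
    obtain g where g: "g \<in> nhd f N \<epsilon> \<inter> U n"
      using dense[OF f(1,2), of N n] by blast
    have "A_open \<Omega> (nhd f N \<epsilon> \<inter> U n)"
      using A_open_nhd[OF f(1)] opn by (rule A_open_Int)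
    then obtain N' \<epsilon>' where *: "Suc n \<le> N'" "0 < \<epsilon>'" "\<epsilon>' \<le> (1/2)^Suc n"
        "closed_nhd g N' \<epsilon>' \<subseteq> nhd f N \<epsilon> \<inter> U n"
      using A_open_contains_closed_nhd[OF _ g, of "Suc n"] by blast
    have "nhd f N \<epsilon> \<subseteq> closed_nhd f N \<epsilon>"
      unfolding nhd_def closed_nhd_def by force
    then have "P (Suc n) (g, N', \<epsilon>')" "Q n x (g, N', \<epsilon>')"
      using * f(3) g unfolding P_def Q_def x by (auto simp: nhd_def)
    then show "\<exists>y. P (Suc n) y \<and> Q n x y" by blast
  qed
  then obtain x where x: "\<And>n. P n (x n)" "\<And>n. Q n (x n) (x (Suc n))" by blast
  define f where "f = (\<lambda>n. fst (x n))"
  define N where "N = (\<lambda>n. fst (snd (x n)))"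
  define \<epsilon> where "\<epsilon> = (\<lambda>n. snd (snd (x n)))"
  have xn: "x n = (f n, N n, \<epsilon> n)" for n
    by (simp add: f_def N_def \<epsilon>_def)
  have P: "f n \<in> A_infty \<Omega>" "n \<le> N n" "0 < \<epsilon> n" "\<epsilon> n \<le> (1/2)^n" "closed_nhd (f n) (N n) (\<epsilon> n) \<subseteq> W" for n
    using x(1)[of n] by (auto simp: xn P_def)
  have Q: "closed_nhd (f (Suc n)) (N (Suc n)) (\<epsilon> (Suc n)) \<subseteq> U n \<inter> closed_nhd (f n) (N n) (\<epsilon> n)" for n
    using x(2)[of n] by (auto simp: xn Q_def)
  have nested: "closed_nhd (f k) (N k) (\<epsilon> k) \<subseteq> closed_nhd (f n) (N n) (\<epsilon> n)" if "n \<le> k" for n k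
    using lift_Suc_antimono_le[of "\<lambda>n. closed_nhd (f n) (N n) (\<epsilon> n)", OF _ that] Q by blast
  have f_in: "f k \<in> closed_nhd (f n) (N n) (\<epsilon> n)" if "n \<le> k" for n k
    using nested[OF that] P(1,3)[of k] by (auto simp: closed_nhd_def seminorm_dist_self less_imp_le)
  have close: "cmod ((deriv ^^ l) (f k) z - (deriv ^^ l) (f n) z) \<le> \<epsilon> n"
    if "n \<le> k" "l \<le> N n" "z \<in> \<Omega>" for n k l z
    using f_in[OF that(1)] that(2) seminorm_dist_ge[OF P(1) P(1) that(3), of l k n]
    by (fastforce simp: closed_nhd_def)
  have "uniformly_Cauchy_on \<Omega> (\<lambda>n. (deriv ^^ l) (f n))" for l
  proof (rule uniformly_Cauchy_onI')
    fix e :: real assume "e > 0"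
    obtain M0 where M0: "(1/2)^M0 < e"
      using real_arch_pow_inv[OF \<open>e > 0\<close>, of "1/2"] by auto
    \<comment> \<open>For \<open>m >= M\<close>, the bound \<open>l <= m <= N m\<close> means that
      stage \<open>m\<close> already controls order \<open>l\<close>, while \<open>M0\<close> makes
      its radius smaller than \<open>e\<close>.\<close>
    define M where "M = max l M0"
    have "dist ((deriv ^^ l) (f m) z) ((deriv ^^ l) (f n) z) < e"
      if "z \<in> \<Omega>" "M \<le> m" "m < n" for z m n
    proof -
      have "(1/2)^m \<le> (1/2::real)^M0"
        using that(2) by (intro power_decreasing) (auto simp: M_def)
      then show ?thesis
        using close[of m n l z] that P(2,4)[of m] M0 unfolding dist_norm norm_minus_commute M_def
        by linarith
    qed
    then show "\<exists>M. \<forall>z\<in>\<Omega>. \<forall>m\<ge>M. \<forall>n>m. dist ((deriv ^^ l) (f m) z) ((deriv ^^ l) (f n) z) < e"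
      by blast
  qed
  then obtain g where g: "g \<in> A_infty \<Omega>"
      and lim: "\<And>l. uniform_limit \<Omega> (\<lambda>n. (deriv ^^ l) (f n)) ((deriv ^^ l) g) sequentially"
    using A_infty_complete[of f] P(1) by metis
  \<comment> \<open>Let \<open>k\<close> tend to infinity in \<open>close\<close> with
    \<open>n\<close> fixed.\<close>
  have "g \<in> closed_nhd (f n) (N n) (\<epsilon> n)" for n
    unfolding closed_nhd_def
  proof (intro CollectI conjI allI impI seminorm_dist_le g)
    fix l z assume "l \<le> N n" "z \<in> \<Omega>"
    have "(\<lambda>k. cmod ((deriv ^^ l) (f k) z - (deriv ^^ l) (f n) z)) \<longlonglongrightarrow>
        cmod ((deriv ^^ l) g z - (deriv ^^ l) (f n) z)"
      by (intro tendsto_intros tendsto_uniform_limitI[OF lim \<open>z \<in> \<Omega>\<close>])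
    then show "cmod ((deriv ^^ l) g z - (deriv ^^ l) (f n) z) \<le> \<epsilon> n"
      using close \<open>l \<le> N n\<close> \<open>z \<in> \<Omega>\<close> by (intro LIMSEQ_le_const2) blast+
  qed
  then have "g \<in> W \<inter> (\<Inter>n. U n)"
    using P(5)[of 0] Q by blast
  then show "W \<inter> (\<Inter>n. U n) \<noteq> {}" by blast
qed

section \<open>Boundary values\<close>

text \<open>The continuous extension of order 0 provides the limit. A frontier point of the open set
  \<open>\<Omega>\<close> lies in its closure but not in it, so it is a limit point and
  \<open>Lim\<close> has its intended meaning.\<close>

lemma boundary_value_tendsto:
  assumes "f \<in> A_infty \<Omega>" "w \<in> frontier \<Omega>"
  shows "(f \<longlongrightarrow> boundary_value \<Omega> f w) (at w within \<Omega>)" and "at w within \<Omega> \<noteq> bot"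
proof -
  have w: "w \<in> closure \<Omega>" "w \<notin> \<Omega>"
    using assms(2) open_\<Omega> by (auto simp: frontier_def interior_open)
  then show nt: "at w within \<Omega> \<noteq> bot"
    using islimpt_in_closure[of w \<Omega>] trivial_limit_within[of w \<Omega>] by simp
  have "\<exists>F. continuous_on (closure \<Omega>) F \<and> (\<forall>z\<in>\<Omega>. F z = (deriv ^^ 0) f z)"
    using assms(1) unfolding A_infty_def by blast
  then obtain F where F: "continuous_on (closure \<Omega>) F" "\<And>z. z \<in> \<Omega> \<Longrightarrow> F z = f z"
    by auto
  have "(F \<longlongrightarrow> F w) (at w within closure \<Omega>)"
    using F(1) w(1) by (simp add: continuous_on_def)
  then have "(F \<longlongrightarrow> F w) (at w within \<Omega>)"
    using closure_subset by (rule tendsto_within_subset)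
  then have "(f \<longlongrightarrow> F w) (at w within \<Omega>)"
    using F(2) by (rule Lim_transform_within[OF _ zero_less_one]) auto
  then show "(f \<longlongrightarrow> boundary_value \<Omega> f w) (at w within \<Omega>)"
    using nt by (simp add: boundary_value_def tendsto_Lim)
qed

lemma boundary_value_eqI:
  assumes "(f \<longlongrightarrow> l) (at w within \<Omega>)" "at w within \<Omega> \<noteq> bot"
  shows "boundary_value \<Omega> f w = l"
  unfolding boundary_value_def using assms(2,1) by (rule tendsto_Lim)

text \<open>Passing to the limit in the pointwise bound shows that taking boundary values is
  continuous for the seminorm of order 0, uniformly along the frontier.\<close>

lemma boundary_value_dist_le:
  assumes "f \<in> A_infty \<Omega>" "g \<in> A_infty \<Omega>" "w \<in> frontier \<Omega>"
  shows "cmod (boundary_value \<Omega> g w - boundary_value \<Omega> f w) \<le> seminorm_dist \<Omega> 0 f g"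
proof (rule tendsto_upperbound)
  show "((\<lambda>z. cmod (g z - f z)) \<longlongrightarrow> cmod (boundary_value \<Omega> g w - boundary_value \<Omega> f w)) (at w within \<Omega>)"
    using assms by (intro tendsto_intros boundary_value_tendsto)
  show "\<forall>\<^sub>F z in at w within \<Omega>. cmod (g z - f z) \<le> seminorm_dist \<Omega> 0 f g"
    using seminorm_dist_ge[OF assms(1,2), of _ 0] by (auto simp: eventually_at_filter)
  show "at w within \<Omega> \<noteq> bot"
    using boundary_value_tendsto(2)[OF assms(1,3)] .
qed

section \<open>Functions with a bounded holomorphic extension of the boundary values\<close>

text \<open>The parameter is complexified: \<open>h\<close> lives on a complex disc and is
  prescribed only on its real diameter. Fixing both the disc and the bound \<open>M\<close> makes a
  sequence of extensions a normal family.\<close>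

definition extendable :: "(real \<Rightarrow> complex) \<Rightarrow> real \<Rightarrow> real \<Rightarrow> real \<Rightarrow> (complex \<Rightarrow> complex) set" where
  "extendable \<gamma> q \<delta> M = {f \<in> A_infty \<Omega>. \<exists>h. h holomorphic_on ball (of_real q) \<delta> \<and>
     (\<forall>s\<in>ball (of_real q) \<delta>. cmod (h s) \<le> M) \<and>
     (\<forall>t. \<bar>t - q\<bar> < \<delta> \<longrightarrow> h (of_real t) = boundary_value \<Omega> f (\<gamma> t))}"

lemma of_real_in_ball_iff: "complex_of_real t \<in> ball (of_real q) \<delta> \<longleftrightarrow> \<bar>t - q\<bar> < \<delta>"
  by (metis abs_minus_commute dist_of_real dist_real_def mem_ball)

text \<open>Closedness is Montel's theorem applied to the extensions.\<close>

lemma A_open_not_extendable: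
  assumes \<gamma>: "range \<gamma> \<subseteq> frontier \<Omega>"
  shows "A_open \<Omega> (A_infty \<Omega> - extendable \<gamma> q \<delta> M)"
  unfolding A_open_iff_nhd
proof (intro conjI ballI)
  fix f assume "f \<in> A_infty \<Omega> - extendable \<gamma> q \<delta> M"
  then have f: "f \<in> A_infty \<Omega>" "f \<notin> extendable \<gamma> q \<delta> M" by auto
  show "\<exists>N. \<exists>\<epsilon>>0. nhd f N \<epsilon> \<subseteq> A_infty \<Omega> - extendable \<gamma> q \<delta> M"
  proof (rule ccontr)
    assume contr: "\<not> ?thesis"
    \<comment> \<open>If no neighbourhood works, order 0 with radii \<open>1 / (n + 1)\<close>
      already yields extendable functions converging to \<open>f\<close>. Only the sup norm matters
      from here on.\<close>
    have "\<exists>g. g \<in> nhd f 0 (inverse (real (Suc n))) \<inter> extendable \<gamma> q \<delta> M" for n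
    proof -
      have "\<not> nhd f 0 (inverse (real (Suc n))) \<subseteq> A_infty \<Omega> - extendable \<gamma> q \<delta> M"
        using contr by (metis inverse_positive_iff_positive of_nat_0_less_iff zero_less_Suc)
      then show ?thesis by (auto simp: nhd_def)
    qed
    then obtain g where g: "\<And>n. g n \<in> nhd f 0 (inverse (real (Suc n)))"
        "\<And>n. g n \<in> extendable \<gamma> q \<delta> M"
      by (metis Int_iff)
    have gA: "g n \<in> A_infty \<Omega>" for n
      using g(1)[of n] by (simp add: nhd_def)
    let ?B = "ball (complex_of_real q) \<delta>"
    have "\<exists>h. h holomorphic_on ?B \<and> (\<forall>s\<in>?B. cmod (h s) \<le> M) \<and>
        (\<forall>t. \<bar>t - q\<bar> < \<delta> \<longrightarrow> h (of_real t) = boundary_value \<Omega> (g n) (\<gamma> t))" for n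
      using g(2)[of n] unfolding extendable_def by blast
    then obtain h where h: "\<And>n. h n holomorphic_on ?B" "\<And>n s. s \<in> ?B \<Longrightarrow> cmod (h n s) \<le> M"
        "\<And>n t. \<bar>t - q\<bar> < \<delta> \<Longrightarrow> h n (of_real t) = boundary_value \<Omega> (g n) (\<gamma> t)"
      by metis
    obtain k r where k: "k holomorphic_on ?B" "strict_mono (r :: nat \<Rightarrow> nat)"
        "\<And>s. s \<in> ?B \<Longrightarrow> (\<lambda>n. h (r n) s) \<longlonglongrightarrow> k s"
          proof (rule Montel[of ?B "range h" h])
      show "\<exists>B. \<forall>k\<in>range h. \<forall>s\<in>K. cmod (k s) \<le> B" if "K \<subseteq> ?B" for K
        using h(2) that by (intro exI[of _ M]) auto
    qed (use h(1) in auto)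
    have bound: "cmod (k s) \<le> M" if "s \<in> ?B" for s
      using tendsto_norm[OF k(3)[OF that]] h(2)[OF that] by (intro LIMSEQ_le_const2) auto
    \<comment> \<open>On the real diameter the whole sequence \<open>h n\<close> converges to the
      boundary values of \<open>f\<close>, so the Montel limit \<open>k\<close> must agree with them
      there.\<close>
    have "k (of_real t) = boundary_value \<Omega> f (\<gamma> t)" if t: "\<bar>t - q\<bar> < \<delta>" for t
    proof (rule LIMSEQ_unique)
      show "(\<lambda>n. h (r n) (of_real t)) \<longlonglongrightarrow> k (of_real t)"
        using t by (intro k(3)) (simp only: of_real_in_ball_iff)
      have "cmod (h n (of_real t) - boundary_value \<Omega> f (\<gamma> t)) \<le> inverse (real (Suc n))" for n
        using boundary_value_dist_le[OF f(1) gA[of n], of "\<gamma> t"] \<gamma> g(1)[of n] h(3)[OF t, of n]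
        by (fastforce simp: nhd_def)
      then have "(\<lambda>n. h n (of_real t) - boundary_value \<Omega> f (\<gamma> t)) \<longlonglongrightarrow> 0"
        by (intro Lim_null_comparison[OF _ LIMSEQ_inverse_real_of_nat] always_eventually allI)
      then have "(\<lambda>n. h n (of_real t)) \<longlonglongrightarrow> boundary_value \<Omega> f (\<gamma> t)"
        by (simp add: LIM_zero_iff)
      then show "(\<lambda>n. h (r n) (of_real t)) \<longlonglongrightarrow> boundary_value \<Omega> f (\<gamma> t)"
        using LIMSEQ_subseq_LIMSEQ[OF _ k(2)] by (auto simp: o_def)
    qed
    then have "f \<in> extendable \<gamma> q \<delta> M"
      using f(1) k(1) bound unfolding extendable_def by blast
    then show False using f(2) by blast
  qed
qed auto

section \<open>Perturbation by functions holomorphic near the closure\<close>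

lemma A_infty_add_cmult_holomorphic:
  assumes f: "f \<in> A_infty \<Omega>" and g: "g holomorphic_on S" "open S" "closure \<Omega> \<subseteq> S"
  shows "(\<lambda>z. f z + c * g z) \<in> A_infty \<Omega>"
    and "\<And>l z. z \<in> \<Omega> \<Longrightarrow>
      (deriv ^^ l) (\<lambda>z. f z + c * g z) z = (deriv ^^ l) f z + c * (deriv ^^ l) g z"
proof -
  have sub: "\<Omega> \<subseteq> S"
    using g(3) closure_subset by blast
  have holf: "f holomorphic_on \<Omega>" and holg: "g holomorphic_on \<Omega>"
    using A_infty_holomorphic[OF f] holomorphic_on_subset[OF g(1) sub] by auto
  show deriv: "(deriv ^^ l) (\<lambda>z. f z + c * g z) z = (deriv ^^ l) f z + c * (deriv ^^ l) g z"
    if "z \<in> \<Omega>" for l z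
    using higher_deriv_add[OF holf holomorphic_on_mult[OF holomorphic_on_const holg] open_\<Omega> that]
      higher_deriv_cmult[OF holg that open_\<Omega>] by simp
  have "\<exists>F. continuous_on (closure \<Omega>) F \<and> (\<forall>z\<in>\<Omega>. F z = (deriv ^^ l) (\<lambda>z. f z + c * g z) z)" for l
  proof -
    obtain F where F: "continuous_on (closure \<Omega>) F" "\<And>z. z \<in> \<Omega> \<Longrightarrow> F z = (deriv ^^ l) f z"
      using f unfolding A_infty_def by blast
    have "continuous_on (closure \<Omega>) ((deriv ^^ l) g)"
      using holomorphic_on_imp_continuous_on[OF holomorphic_higher_deriv[OF g(1,2)]] g(3)
      by (rule continuous_on_subset)
    then have "continuous_on (closure \<Omega>) (\<lambda>z. F z + c * (deriv ^^ l) g z)"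
      using F(1) by (intro continuous_intros)
    then show ?thesis
      using F(2) deriv by (intro exI[of _ "\<lambda>z. F z + c * (deriv ^^ l) g z"]) simp
  qed
  then show "(\<lambda>z. f z + c * g z) \<in> A_infty \<Omega>"
    unfolding A_infty_def using holf holg by (auto intro!: holomorphic_intros)
qed

text \<open>Perturbing by \<open>c / (z - w)\<close> destroys extendability: by the identity theorem the
  difference of the two extensions would be \<open>c / (G s - w)\<close>, which has a pole where \<open>G s = w\<close>.\<close>

lemma not_extendable_nhd_dense:
  assumes \<gamma>: "range \<gamma> \<subseteq> frontier \<Omega>" and "\<delta> > 0"
    and holG: "G holomorphic_on ball (of_real q) \<delta>"
    and G: "\<And>t. \<bar>t - q\<bar> < \<delta> \<Longrightarrow> G (of_real t) = \<gamma> t"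
    and s: "s \<in> ball (of_real q) \<delta>" "G s \<notin> closure \<Omega>"
    and \<delta>': "\<delta> \<le> \<delta>'"
    and f: "f \<in> A_infty \<Omega>" and "\<epsilon> > 0"
  shows "nhd f N \<epsilon> \<inter> (A_infty \<Omega> - extendable \<gamma> q \<delta>' M) \<noteq> {}"
proof (cases "f \<in> extendable \<gamma> q \<delta>' M")
  case False
  then show ?thesis
    using centre_in_nhd[OF f \<open>\<epsilon> > 0\<close>] f by blast
next
  case True
  define g where "g = (\<lambda>z. 1 / (z - G s))"
  have holg: "g holomorphic_on - {G s}" and og: "open (- {G s})" and cl: "closure \<Omega> \<subseteq> - {G s}"
    unfolding g_def using s(2) by (auto intro!: holomorphic_intros)
  \<comment> \<open>Perturbing the zero function with factor 1 puts \<open>g\<close> itself in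
    \<open>A_infty\<close>, hence bounds all its derivatives.\<close>
  have "(\<lambda>z. 0) \<in> A_infty \<Omega>"
  proof -
    have "\<And>l. (deriv ^^ l) (\<lambda>z::complex. 0::complex) = (\<lambda>z. 0)"
      by (induct_tac l) simp_all
    then show ?thesis
      unfolding A_infty_def by (auto intro!: exI[of _ "\<lambda>z. 0"])
  qed
  then have "g \<in> A_infty \<Omega>"
    using A_infty_add_cmult_holomorphic(1)[OF _ holg og cl, of "\<lambda>z. 0" 1] by simp
  then obtain B where B: "\<And>l z. z \<in> \<Omega> \<Longrightarrow> cmod ((deriv ^^ l) g z) \<le> B l"
    using A_infty_deriv_bounded[of g] by metis
  \<comment> \<open>The summand 1 makes \<open>C\<close> positive and strictly larger than every
    \<open>B l\<close> with \<open>l <= N\<close>, so the factor \<open>\<epsilon> / C\<close> keeps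
    all these seminorms below \<open>\<epsilon>\<close>.\<close>
  define C where "C = 1 + (\<Sum>l\<le>N. \<bar>B l\<bar>)"
  have "C > 0"
    unfolding C_def by (intro add_pos_nonneg sum_nonneg) auto
  have BC: "B l < C" if "l \<le> N" for l
    using member_le_sum[of l "{..N}" "\<lambda>l. \<bar>B l\<bar>"] that by (simp add: C_def)
  define c where "c = \<epsilon> / C"
  have "c > 0"
    using \<open>\<epsilon> > 0\<close> \<open>C > 0\<close> by (simp add: c_def)
  define fg where "fg = (\<lambda>z. f z + of_real c * g z)"
  have fg: "fg \<in> A_infty \<Omega>"
    and fg': "\<And>l z. z \<in> \<Omega> \<Longrightarrow> (deriv ^^ l) fg z = (deriv ^^ l) f z + of_real c * (deriv ^^ l) g z"
    unfolding fg_def using A_infty_add_cmult_holomorphic[OF f holg og cl] by blast+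
  have "fg \<in> nhd f N \<epsilon>"
    unfolding nhd_def
  proof (intro CollectI conjI allI impI fg)
    fix l assume "l \<le> N"
    have "seminorm_dist \<Omega> l f fg \<le> c * B l"
      using B \<open>c > 0\<close> by (intro seminorm_dist_le) (simp add: fg' norm_mult)
    also have "\<dots> < c * C"
      using BC[OF \<open>l \<le> N\<close>] \<open>c > 0\<close> by simp
    finally show "seminorm_dist \<Omega> l f fg < \<epsilon>"
      using \<open>C > 0\<close> by (simp add: c_def)
  qed
  moreover have "fg \<notin> extendable \<gamma> q \<delta>' M"
  proof
    assume "fg \<in> extendable \<gamma> q \<delta>' M"
    then obtain h2 where h2: "h2 holomorphic_on ball (of_real q) \<delta>'"
        "\<And>t. \<bar>t - q\<bar> < \<delta>' \<Longrightarrow> h2 (of_real t) = boundary_value \<Omega> fg (\<gamma> t)"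
      unfolding extendable_def by blast
    obtain h1 where h1: "h1 holomorphic_on ball (of_real q) \<delta>'"
        "\<And>t. \<bar>t - q\<bar> < \<delta>' \<Longrightarrow> h1 (of_real t) = boundary_value \<Omega> f (\<gamma> t)"
      using True unfolding extendable_def by blast
    let ?B = "ball (complex_of_real q) \<delta>"
    have subB: "?B \<subseteq> ball (of_real q) \<delta>'"
      using \<delta>' by (rule subset_ball)
    \<comment> \<open>This clears the denominator in \<open>h2 - h1 = c / (G - G s)\<close>, which
      holds on the real diameter. Thus \<open>H\<close> vanishes there, although its value at
      \<open>s\<close> is \<open>- c\<close>.\<close>
    define H where "H = (\<lambda>u. (h2 u - h1 u) * (G u - G s) - of_real c)"
    have holH: "H holomorphic_on ?B"
      unfolding H_def using holomorphic_on_subset[OF h1(1) subB] holomorphic_on_subset[OF h2(1) subB] holG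
      by (intro holomorphic_intros)
    have H0: "H (of_real t) = 0" if t: "\<bar>t - q\<bar> < \<delta>" for t
    proof -
      have w: "\<gamma> t \<in> frontier \<Omega>" using \<gamma> by blast
      then have ne: "\<gamma> t \<noteq> G s"
        using s(2) by (auto simp: frontier_def)
      have "(g \<longlongrightarrow> g (\<gamma> t)) (at (\<gamma> t) within \<Omega>)"
        unfolding g_def using ne by (intro tendsto_intros) auto
      then have "(fg \<longlongrightarrow> boundary_value \<Omega> f (\<gamma> t) + of_real c * g (\<gamma> t)) (at (\<gamma> t) within \<Omega>)"
        unfolding fg_def using boundary_value_tendsto(1)[OF f w] by (intro tendsto_intros)
      then have "boundary_value \<Omega> fg (\<gamma> t) = boundary_value \<Omega> f (\<gamma> t) + of_real c * g (\<gamma> t)"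
        using boundary_value_tendsto(2)[OF f w] by (rule boundary_value_eqI)
      then show ?thesis
        using h1(2)[of t] h2(2)[of t] t \<delta>' G[OF t] ne by (simp add: H_def g_def)
    qed
    have "H s = 0"
    proof (rule analytic_continuation[OF holH _ _ _ _ _ _ s(1)])
      show "complex_of_real ` {t. \<bar>t - q\<bar> < \<delta>} \<subseteq> ?B"
        using of_real_in_ball_iff by blast
      show "complex_of_real q \<in> ?B"
        using \<open>\<delta> > 0\<close> by simp
      show "complex_of_real q islimpt complex_of_real ` {t. \<bar>t - q\<bar> < \<delta>}"
        unfolding islimpt_approachable
      proof (intro allI impI)
        fix e :: real assume "e > 0"
        define t where "t = q + min e \<delta> / 2"
        have "\<bar>t - q\<bar> < \<delta>" "t \<noteq> q" "dist (complex_of_real t) (of_real q) < e"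
          using \<open>e > 0\<close> \<open>\<delta> > 0\<close> by (auto simp: t_def dist_of_real dist_real_def min_def simp del: of_real_add)
        then show "\<exists>x'\<in>complex_of_real ` {t. \<bar>t - q\<bar> < \<delta>}. x' \<noteq> of_real q \<and> dist x' (of_real q) < e"
          by auto
      qed
    qed (use H0 in auto)
    then show False
      using \<open>c > 0\<close> by (simp add: H_def)
  qed
  ultimately show ?thesis
    using fg by blast
qed

section \<open>Real analyticity somewhere as a countable union of conditions\<close>

text \<open>A convergent power series also converges for complex parameters, and a smaller disc with
  rational centre and radius \<open>1 / (k + 1)\<close> fits inside its disc. Conversely, the Taylor
  series of an extension at \<open>q\<close> witnesses analyticity at \<open>q\<close>.\<close>

lemma real_analytic_iff_extendable:
  assumes "f \<in> A_infty \<Omega>"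
  shows "(\<exists>t0. real_analytic_at_param (boundary_value \<Omega> f) \<gamma> t0) \<longleftrightarrow>
    (\<exists>q\<in>\<rat>. \<exists>k M :: nat. f \<in> extendable \<gamma> q (1 / real (Suc k)) (real M))"
proof
  assume "\<exists>t0. real_analytic_at_param (boundary_value \<Omega> f) \<gamma> t0"
  then obtain t0 a \<delta> where "\<delta> > 0" and a: "ereal \<delta> \<le> conv_radius a"
      and sums: "\<And>t. \<bar>t - t0\<bar> < \<delta> \<Longrightarrow> (\<lambda>n. a n * of_real (t - t0) ^ n) sums boundary_value \<Omega> f (\<gamma> t)"
    unfolding real_analytic_at_param_def by blast
  define h where "h = (\<lambda>s. \<Sum>n. a n * (s - complex_of_real t0) ^ n)"
  have "h holomorphic_on ball (of_real t0) \<delta>"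
  proof (rule power_series_holomorphic)
    fix s assume "s \<in> ball (complex_of_real t0) \<delta>"
    then have "cmod (s - of_real t0) < \<delta>"
      by (simp add: dist_norm norm_minus_commute)
    then have "ereal (cmod (s - of_real t0)) < conv_radius a"
      using a by (meson ereal_less(2) less_ereal.simps(1) order_less_le_trans)
    then show "(\<lambda>n. a n * (s - of_real t0) ^ n) sums h s"
      unfolding h_def using summable_in_conv_radius summable_sums by blast
  qed
  \<comment> \<open>Radius and displacement of the centre both stay below
    \<open>\<delta> / 2\<close>, so even the closed disc fits; its compactness provides the bound
    \<open>M\<close>.\<close>
  obtain k where k: "1 / real (Suc k) < \<delta> / 2"
    using \<open>\<delta> > 0\<close> by (metis half_gt_zero nat_approx_posE)
  obtain q where q: "q \<in> \<rat>" "t0 < q" "q < t0 + \<delta> / 2"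
    using Rats_dense_in_real[of t0 "t0 + \<delta> / 2"] \<open>\<delta> > 0\<close> by auto
  let ?r = "1 / real (Suc k)"
  have sub: "cball (complex_of_real q) ?r \<subseteq> ball (of_real t0) \<delta>"
  proof
    fix s assume "s \<in> cball (complex_of_real q) ?r"
    moreover have "dist (complex_of_real t0) (of_real q) < \<delta> / 2"
      using q by (simp add: dist_of_real dist_real_def)
    ultimately show "s \<in> ball (of_real t0) \<delta>"
      using k dist_triangle[of "complex_of_real t0" s "of_real q"] by simp
  qed
  have holq: "h holomorphic_on cball (of_real q) ?r"
    using \<open>h holomorphic_on _\<close> sub by (rule holomorphic_on_subset)
  have "compact (h ` cball (of_real q) ?r)"
    using holomorphic_on_imp_continuous_on[OF holq] by (intro compact_continuous_image) auto
  then have "bounded (h ` cball (of_real q) ?r)"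
    by (rule compact_imp_bounded)
  then obtain B where B: "\<And>s. s \<in> cball (of_real q) ?r \<Longrightarrow> cmod (h s) \<le> B"
    unfolding bounded_iff by (auto simp del: mem_cball)
  obtain M :: nat where "B \<le> real M"
    using real_arch_simple by blast
  have "h (of_real t) = boundary_value \<Omega> f (\<gamma> t)" if "\<bar>t - q\<bar> < ?r" for t
  proof -
    have "complex_of_real t \<in> cball (of_real q) ?r"
      using that of_real_in_ball_iff[of t q] ball_subset_cball by blast
    then have "\<bar>t - t0\<bar> < \<delta>"
      using sub of_real_in_ball_iff by blast
    from sums_unique[OF sums[OF this]] show ?thesis
      by (simp add: h_def)
  qed
  moreover have "h holomorphic_on ball (of_real q) ?r"
    using holq ball_subset_cball by (rule holomorphic_on_subset)
  moreover have "cmod (h s) \<le> real M" if "s \<in> ball (of_real q) ?r" for s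
    using B[of s] that \<open>B \<le> real M\<close> by simp
  ultimately have "f \<in> extendable \<gamma> q ?r (real M)"
    using assms unfolding extendable_def by blast
  then show "\<exists>q\<in>\<rat>. \<exists>k M :: nat. f \<in> extendable \<gamma> q (1 / real (Suc k)) (real M)"
    using q(1) by blast
next
  assume "\<exists>q\<in>\<rat>. \<exists>k M :: nat. f \<in> extendable \<gamma> q (1 / real (Suc k)) (real M)"
  then obtain q and k M :: nat where "f \<in> extendable \<gamma> q (1 / real (Suc k)) (real M)" by blast
  moreover define \<delta> where "\<delta> = 1 / real (Suc k)"
  ultimately obtain h where h: "h holomorphic_on ball (of_real q) \<delta>"
      "\<And>t. \<bar>t - q\<bar> < \<delta> \<Longrightarrow> h (of_real t) = boundary_value \<Omega> f (\<gamma> t)"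
    unfolding extendable_def by blast
  define a where "a = (\<lambda>n. (deriv ^^ n) h (of_real q) / fact n)"
  have sums: "(\<lambda>n. a n * of_real (t - q) ^ n) sums h (of_real t)" if "\<bar>t - q\<bar> < \<delta>" for t
    using holomorphic_power_series[OF h(1), of "of_real t"] that of_real_in_ball_iff
    by (simp add: a_def)
  \<comment> \<open>Summability at positive real radii below \<open>\<delta>\<close> suffices, and
    it is read off at the parameters \<open>q + r\<close>.\<close>
  have "ereal \<delta> \<le> conv_radius a"
  proof (rule conv_radius_geI_ex')
    fix r assume "0 < r" "ereal r < ereal \<delta>"
    then show "summable (\<lambda>n. a n * of_real r ^ n)"
      using sums[of "q + r"] by (auto simp: sums_iff)
  qed
  moreover have "\<delta> > 0"
    by (simp add: \<delta>_def)
  ultimately show "\<exists>t0. real_analytic_at_param (boundary_value \<Omega> f) \<gamma> t0"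
    unfolding real_analytic_at_param_def using sums h(2) by metis
qed

end

section \<open>Exterior points near an analytic Jordan curve\<close>

text \<open>Rescaling one period to the unit interval gives the form required by the Jordan curve
  theorem. Injectivity of \<open>\<Phi>\<close> reduces coincidences of \<open>c\<close> to those of
  the exponential, which occur exactly at integer differences.\<close>

lemma analytic_jordan_curve_simple_loop:
  assumes "analytic_jordan_param \<Phi> \<rho> R"
  defines "c \<equiv> \<lambda>x. curve_of \<Phi> (2 * pi * x)"
  shows "simple_path c" "pathfinish c = pathstart c" "path_image c = curve_image \<Phi>"
proof -
  let ?A = "{z. \<rho> < cmod z \<and> cmod z < R}"
  have \<Phi>: "\<Phi> holomorphic_on ?A" "inj_on \<Phi> ?A" "\<rho> < 1" "1 < R"
    using assms(1) unfolding analytic_jordan_param_def by auto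
  have circ: "exp (\<i> * of_real t) \<in> ?A" for t
    using \<Phi>(3,4) by simp
  have "continuous_on UNIV (\<lambda>x. \<Phi> (exp (\<i> * of_real (2 * pi * x))))"
    by (rule continuous_on_compose2[OF holomorphic_on_imp_continuous_on[OF \<Phi>(1)]])
      (use circ in \<open>auto intro!: continuous_intros\<close>)
  then have path: "path c"
    unfolding path_def c_def curve_of_def by (rule continuous_on_subset) auto
  have inj: "\<exists>n::int. x = y + of_int n" if "c x = c y" for x y
  proof -
    have "exp (\<i> * of_real (2 * pi * x)) = exp (\<i> * of_real (2 * pi * y))"
      using that inj_onD[OF \<Phi>(2) _ circ circ] unfolding c_def curve_of_def by blast
    then obtain n :: int where "\<i> * of_real (2 * pi * x) = \<i> * of_real (2 * pi * y) + (of_int (2 * n) * pi) * \<i>"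
      unfolding exp_eq by blast
    then have "2 * pi * x = 2 * pi * y + of_int (2 * n) * pi"
      by (auto dest!: arg_cong[of _ _ Im])
    then have "2 * pi * x = 2 * pi * (y + of_int n)"
      by (simp add: algebra_simps)
    then have "x = y + of_int n"
      by simp
    then show ?thesis ..
  qed
  have "loop_free c"
    unfolding loop_free_def
  proof (intro ballI impI)
    fix x y :: real assume xy: "x \<in> {0..1}" "y \<in> {0..1}" "c x = c y"
    obtain n :: int where n: "x = y + of_int n"
      using inj[OF xy(3)] by blast
    then have "real_of_int n \<le> 1" "- 1 \<le> real_of_int n"
      using xy by auto
    then have "n = 0 \<or> n = 1 \<or> n = -1"
      by linarith
    then show "x = y \<or> x = 0 \<and> y = 1 \<or> x = 1 \<and> y = 0"
      using n xy by auto
  qed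
  then show "simple_path c"
    using path by (simp add: simple_path_def)
  have periodic: "c (x + of_int n) = c x" for x and n :: int
  proof -
    have "exp (\<i> * of_real (2 * pi * (x + of_int n))) = exp (\<i> * complex_of_real (2 * pi * x))"
      unfolding exp_eq by (intro exI[of _ n]) (simp add: algebra_simps)
    then show ?thesis
      by (simp add: c_def curve_of_def)
  qed
  show "pathfinish c = pathstart c"
    using periodic[of 0 1] by (simp add: pathfinish_def pathstart_def)
  have "curve_of \<Phi> t \<in> path_image c" for t
  proof -
    have "curve_of \<Phi> t = c (t / (2 * pi))"
      by (simp add: c_def)
    also have "\<dots> = c (frac (t / (2 * pi)))"
      using periodic[of "frac (t / (2 * pi))" "\<lfloor>t / (2 * pi)\<rfloor>"] by (simp add: frac_def)
    finally show ?thesis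
      using frac_ge_0[of "t / (2 * pi)"] frac_lt_1[of "t / (2 * pi)"]
      by (auto simp: path_image_def intro!: imageI)
  qed
  then show "path_image c = curve_image \<Phi>"
    by (auto simp: curve_image_def path_image_def c_def)
qed

text \<open>A connected set missing the curve lies on one side of the curve, and the curve is the frontier of the
  other side.\<close>

lemma open_meets_exterior:
  assumes jp: "analytic_jordan_param \<Phi> \<rho> R"
    and "connected \<Omega>" and disj: "\<Omega> \<inter> curve_image \<Phi> = {}"
    and V: "open V" "V \<inter> curve_image \<Phi> \<noteq> {}"
  shows "\<not> V \<subseteq> closure \<Omega>"
proof -
  let ?C = "curve_image \<Phi>"
  note loop = analytic_jordan_curve_simple_loop[OF jp]
  have J: "open (inside ?C)" "open (outside ?C)" "inside ?C \<inter> outside ?C = {}"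
      "inside ?C \<union> outside ?C = - ?C" "frontier (inside ?C) = ?C" "frontier (outside ?C) = ?C"
    using Jordan_inside_outside[OF loop(1,2)] unfolding loop(3) by blast+
  have "\<Omega> \<inter> inside ?C = {} \<or> \<Omega> \<inter> outside ?C = {}"
    using connectedD[OF \<open>connected \<Omega>\<close> J(1,2)] J(3,4) disj by blast
  then obtain S where S: "open S" "frontier S = ?C" "S \<inter> \<Omega> = {}"
    using J by blast
  \<comment> \<open>\<open>S\<close> is the side missed by \<open>\<Omega>\<close>. An open set
    meeting its frontier meets \<open>S\<close>, and \<open>S\<close>, being open, also misses
    \<open>closure \<Omega>\<close>.\<close>
  have "V \<inter> closure S \<noteq> {}"
    using V(2) S(2) by (auto simp: frontier_def)
  then have "V \<inter> S \<noteq> {}"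
    using open_Int_closure_eq_empty[OF V(1)] by blast
  moreover have "S \<inter> closure \<Omega> = {}"
    using S(3) open_Int_closure_eq_empty[OF S(1)] by blast
  ultimately show ?thesis by blast
qed

text \<open>The curve extends to complex parameters through \<open>exp (\<i> * s)\<close>, as long
  as this stays in the annulus. Openness of the image is what lets it reach beyond
  \<open>closure \<Omega>\<close>.\<close>

lemma analytic_jordan_curve_extension:
  assumes jp: "analytic_jordan_param \<Phi> \<rho> R" and "\<delta>' > 0"
  obtains \<delta> where "0 < \<delta>" "\<delta> \<le> \<delta>'"
    and "(\<lambda>s. \<Phi> (exp (\<i> * s))) holomorphic_on ball (of_real q) \<delta>"
    and "open ((\<lambda>s. \<Phi> (exp (\<i> * s))) ` ball (of_real q) \<delta>)"
proof -
  let ?A = "{z. \<rho> < cmod z \<and> cmod z < R}"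
  have \<Phi>: "\<Phi> holomorphic_on ?A" "inj_on \<Phi> ?A" "\<rho> < 1" "1 < R"
    using jp unfolding analytic_jordan_param_def by auto
  have "open ?A"
    by (intro open_Collect_conj open_Collect_less continuous_intros)
  let ?e = "\<lambda>s. exp (\<i> * s)"
  have "open (?e -` ?A)"
    using \<open>open ?A\<close> by (intro open_vimage continuous_intros)
  moreover have "complex_of_real q \<in> ?e -` ?A"
    using \<Phi>(3,4) by simp
  ultimately obtain d where d: "d > 0" "ball (complex_of_real q) d \<subseteq> ?e -` ?A"
    using open_contains_ball_eq by blast
  \<comment> \<open>With radius at most 1, two points of the disc differ by less than 2, hence by
    less than the period \<open>2 * pi\<close>. The exponential, and with it the composition, is
    therefore injective.\<close>
  define \<delta> where "\<delta> = min d (min \<delta>' 1)"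
  let ?B = "ball (complex_of_real q) \<delta>"
  have sub: "?e ` ?B \<subseteq> ?A"
    using d(2) by (auto simp: \<delta>_def)
  have inj: "inj_on ?e ?B"
  proof (rule inj_onI)
    fix s u assume su: "s \<in> ?B" "u \<in> ?B" "?e s = ?e u"
    then obtain n :: int where "\<i> * s = \<i> * u + (of_int (2 * n) * pi) * \<i>"
      unfolding exp_eq by blast
    then have "\<i> * (s - u) = \<i> * (of_int (2 * n) * pi)"
      by (simp add: algebra_simps)
    then have n: "s - u = of_real (of_int (2 * n) * pi)"
      by simp
    have "cmod (s - u) < 2"
      using su dist_triangle3[of s u "of_real q"] by (simp add: dist_norm \<delta>_def)
    then have "\<bar>real_of_int n\<bar> * (2 * pi) < 2 * 1"
      unfolding n norm_of_real by (simp add: abs_mult mult_ac)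
    then have "\<bar>real_of_int n\<bar> < 1"
      using mult_left_mono[of 2 "2 * pi" "\<bar>real_of_int n\<bar>"] pi_gt3 by linarith
    then have "n = 0" by linarith
    then show "s = u" using n by simp
  qed
  have hol: "(\<lambda>s. \<Phi> (?e s)) holomorphic_on ?B"
    using holomorphic_on_compose_gen[OF _ \<Phi>(1) sub] by (auto simp: o_def intro!: holomorphic_intros)
  have "inj_on (\<lambda>s. \<Phi> (?e s)) ?B"
    using comp_inj_on[OF inj inj_on_subset[OF \<Phi>(2) sub]] by (simp add: o_def)
  then have "open ((\<lambda>s. \<Phi> (?e s)) ` ?B)"
    using hol by (intro open_mapping_thm3) auto
  then show ?thesis
    using hol d(1) \<open>\<delta>' > 0\<close> by (intro that[of \<delta>]) (auto simp: \<delta>_def)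
qed

section \<open>Assembling the countable intersection\<close>

theorem theorem5p18:
  fixes \<Omega> :: "complex set" and m :: nat
    and \<Phi> :: "nat \<Rightarrow> complex \<Rightarrow> complex" and \<rho> R :: "nat \<Rightarrow> real"
  assumes "open \<Omega>" and "connected \<Omega>" and "\<Omega> \<noteq> {}" and "bounded \<Omega>"
    and "\<And>j. j \<in> {1..m} \<Longrightarrow> analytic_jordan_param (\<Phi> j) (\<rho> j) (R j)"
    and "\<And>i j. i \<in> {1..m} \<Longrightarrow> j \<in> {1..m} \<Longrightarrow> i \<noteq> j \<Longrightarrow>
           curve_image (\<Phi> i) \<inter> curve_image (\<Phi> j) = {}"
    and "frontier \<Omega> = (\<Union>j\<in>{1..m}. curve_image (\<Phi> j))"
  shows "A_dense \<Omega> {f \<in> A_infty \<Omega>. \<forall>j\<in>{1..m}. \<forall>t0::real.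
             \<not> real_analytic_at_param (boundary_value \<Omega> f) (curve_of (\<Phi> j)) t0}
       \<and> A_G_delta \<Omega> {f \<in> A_infty \<Omega>. \<forall>j\<in>{1..m}. \<forall>t0::real.
             \<not> real_analytic_at_param (boundary_value \<Omega> f) (curve_of (\<Phi> j)) t0}"
    (is "A_dense \<Omega> ?S \<and> A_G_delta \<Omega> ?S")
proof -
  interpret bounded_open \<Omega>
    using assms(1,3,4) by unfold_locales
  \<comment> \<open>An index records the curve, the rational centre, the radius
    \<open>1 / (k + 1)\<close> and the bound, so there are countably many.\<close>
  define I :: "(nat \<times> real \<times> nat \<times> nat) set" where "I = {1..m} \<times> \<rat> \<times> UNIV \<times> UNIV"
  define E where "E = (\<lambda>(j, q, k, M). extendable (curve_of (\<Phi> j)) q (1 / real (Suc k)) (real M))"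
  have curve: "range (curve_of (\<Phi> j)) \<subseteq> frontier \<Omega>" if "j \<in> {1..m}" for j
    using assms(7) that by (auto simp: curve_image_def)
  have E_open: "A_open \<Omega> (A_infty \<Omega> - E i)" if "i \<in> I" for i
    using that A_open_not_extendable[OF curve] by (auto simp: I_def E_def)
  have E_dense: "nhd f N \<epsilon> \<inter> (A_infty \<Omega> - E i) \<noteq> {}"
    if i: "i \<in> I" and f: "f \<in> A_infty \<Omega>" "\<epsilon> > 0" for i f N \<epsilon>
  proof -
    obtain j q k M where i_eq: "i = (j, q, k, M)" and j: "j \<in> {1..m}"
      using i by (auto simp: I_def)
    let ?G = "\<lambda>s. \<Phi> j (exp (\<i> * s))"
    have "1 / real (Suc k) > 0" by simp
    then obtain \<delta> where \<delta>: "0 < \<delta>" "\<delta> \<le> 1 / real (Suc k)"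
        "?G holomorphic_on ball (of_real q) \<delta>" "open (?G ` ball (of_real q) \<delta>)"
      using analytic_jordan_curve_extension[OF assms(5)[OF j]] by blast
    have "\<Omega> \<inter> curve_image (\<Phi> j) = {}"
      using curve[OF j] assms(1) by (auto simp: curve_image_def frontier_def interior_open)
    \<comment> \<open>The centre of the disc is mapped onto the curve, so the open image meets it
      and the exterior lemma applies.\<close>
    moreover have "curve_of (\<Phi> j) q \<in> ?G ` ball (of_real q) \<delta> \<inter> curve_image (\<Phi> j)"
      using \<delta>(1) by (auto simp: curve_image_def curve_of_def)
    ultimately have "\<not> ?G ` ball (of_real q) \<delta> \<subseteq> closure \<Omega>"
      using open_meets_exterior[OF assms(5)[OF j] assms(2) _ \<delta>(4)] by blast
    then obtain s where "s \<in> ball (of_real q) \<delta>" "?G s \<notin> closure \<Omega>"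
      by blast
    then show ?thesis
      using not_extendable_nhd_dense[OF curve[OF j] \<delta>(1,3) _ _ _ \<delta>(2) f, of s N "real M"]
      by (simp add: i_eq E_def curve_of_def)
  qed
  \<comment> \<open>Numbers coding no index receive the whole space, which is open and dense and
    leaves the intersection unchanged within \<open>A_infty\<close>.\<close>
  define U where "U = (\<lambda>n. if n \<in> to_nat_on I ` I then A_infty \<Omega> - E (from_nat_into I n) else A_infty \<Omega>)"
  have "countable I"
    unfolding I_def by (intro countable_SIGMA countable_rat) auto
  then have from_nat: "from_nat_into I n \<in> I" if "n \<in> to_nat_on I ` I" for n
    using that by auto
  have U_open: "A_open \<Omega> (U n)" for n
    using E_open from_nat[of n] A_open_A_infty by (simp add: U_def)
  have U_dense: "nhd f N \<epsilon> \<inter> U n \<noteq> {}" if "f \<in> A_infty \<Omega>" "\<epsilon> > 0" for n f N \<epsilon>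
  proof (cases "n \<in> to_nat_on I ` I")
    case True
    then show ?thesis
      using E_dense[OF from_nat that] by (simp add: U_def)
  next
    case False
    then show ?thesis
      using centre_in_nhd[OF that, of N] that(1) by (auto simp: U_def)
  qed
  have "(\<Inter>n. U n) = A_infty \<Omega> - (\<Union>i\<in>I. E i)"
  proof (intro equalityI subsetI)
    fix f assume f: "f \<in> (\<Inter>n. U n)"
    have "f \<in> A_infty \<Omega>"
      using f U_open[of 0] by (auto simp: A_open_def)
    moreover have "f \<notin> E i" if "i \<in> I" for i
    proof -
      have "f \<in> U (to_nat_on I i)" using f by blast
      then show ?thesis
        using that \<open>countable I\<close> by (simp add: U_def)
    qed
    ultimately show "f \<in> A_infty \<Omega> - (\<Union>i\<in>I. E i)" by blast
  next
    fix f assume "f \<in> A_infty \<Omega> - (\<Union>i\<in>I. E i)"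
    then show "f \<in> (\<Inter>n. U n)"
      using from_nat by (auto simp: U_def)
  qed
  also have "\<dots> = ?S"
  proof -
    have "(\<forall>i\<in>I. f \<notin> E i) \<longleftrightarrow> (\<forall>j\<in>{1..m}. \<forall>t0.
        \<not> real_analytic_at_param (boundary_value \<Omega> f) (curve_of (\<Phi> j)) t0)"
      if "f \<in> A_infty \<Omega>" for f
    proof -
      have "(\<forall>i\<in>I. f \<notin> E i) \<longleftrightarrow> (\<forall>j\<in>{1..m}. \<not> (\<exists>q\<in>\<rat>. \<exists>k M :: nat.
          f \<in> extendable (curve_of (\<Phi> j)) q (1 / real (Suc k)) (real M)))"
        by (auto simp: I_def E_def)
      then show ?thesis
        by (simp only: real_analytic_iff_extendable[OF that, symmetric] not_ex)
    qed
    then show ?thesis by blast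
  qed
  finally have S: "(\<Inter>n. U n) = ?S" .
  have "A_dense \<Omega> (\<Inter>n. U n)"
    using U_open U_dense by (rule A_infty_Baire)
  moreover have "A_G_delta \<Omega> (\<Inter>n. U n)"
    using U_open by (auto simp: A_G_delta_def)
  ultimately show ?thesis
    unfolding S by blast
qed

end
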